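(* Markov's rule $\mathsf{MR}$ in $\mathbf{HA}$ implies each of the rules $\mathsf{HMR_{Nt}}$, $\mathsf{HMR_{W1}}$, $\mathsf{HMR_{W2}}$ and $\mathsf{HMR_{W3}}$ in $\mathbf{MEA}$; that is, if $\mathbf{HA}$ is closed under $\mathsf{MR}$, then $\mathbf{MEA}$ is closed under each of these four rules.
   Context: $\mathbf{HA}$ is Heyting arithmetic. $\mathbf{MEA}$ is Horsten's modal-epistemic arithmetic: classical Peano arithmetic in a language with two primitive unary operators $\Box$ (necessity) and $P$ (proof), with $\Diamond A := \neg\Box\neg A$, and the additional axioms and rules: M*1 $\Box A\supset A$; M*2 $\Box A\wedge\Box(A\supset B)\supset\Box B$; M*3 from $\vdash A$ infer $\vdash\Box A$; M*4 $\Diamond A\supset\Box\Diamond A$; M*5 $\Diamond A\supset A$ for $A$ containing neither $\Box$ nor $P$; M*6 $\Diamond\exists xA\supset\exists x\Diamond A$; E*1 $PA\supset A$; E*2 $PA\supset PPA$; ME*1 from $\vdash A$ infer $\vdash\Diamond PA$; ME*2 $\Diamond PA\wedge\Diamond P(A\supset B)\supset\Diamond PB$. Throughout, $R(x,y)$ is $f(x,y)=0$ for some binary primitive recursive function symbol $f$. Markov's rule in $\mathbf{HA}$: $\mathsf{MR}$: $\vdash_{\mathbf{HA}}\forall x\neg\neg\exists yR(x,y)\Rightarrow\ \vdash_{\mathbf{HA}}\forall x\exists yR(x,y)$. The rules for $\mathbf{MEA}$: $\mathsf{HMR_{Nt}}$: $\vdash_{\mathbf{MEA}}\Diamond P\forall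 x\neg\Diamond P\neg\exists yR(x,y)\Rightarrow\ \vdash_{\mathbf{MEA}}\Diamond P\forall x\exists yR(x,y)$. $\mathsf{HMR_{W1}}$: $\vdash_{\mathbf{MEA}}\Diamond\forall x\Diamond P\exists yR(x,y)\Rightarrow\ \vdash_{\mathbf{MEA}}\Diamond P\forall x\exists yR(x,y)$. $\mathsf{HMR_{W2}}$: $\vdash_{\mathbf{MEA}}\Box\forall x\neg\Diamond P\neg\exists yR(x,y)\Rightarrow\ \vdash_{\mathbf{MEA}}\Box\forall x\exists yR(x,y)$. $\mathsf{HMR_{W3}}$: $\vdash_{\mathbf{MEA}}\Box\forall x\Diamond\exists yR(x,y)\Rightarrow\ \vdash_{\mathbf{MEA}}\Box\forall x\exists yR(x,y)$. *)

theory Defs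
  imports Main
begin

section \<open>Language\<close>

text \<open>Function symbols are descriptions of primitive recursive functions. In \<open>PProj n i\<close> and
  \<open>PComp n g hs\<close> the number \<open>n\<close> is the arity of the described function (it cannot be recovered
  from \<open>hs\<close> when \<open>hs\<close> is empty). The recursion argument of \<open>PRec g h\<close> comes first.\<close>

datatype prsym =
    PZero
  | PSucc
  | PProj nat nat
  | PComp nat prsym "prsym list"
  | PRec prsym prsym

fun arity :: "prsym \<Rightarrow> nat" where
  "arity PZero = 0"
| "arity PSucc = 1"
| "arity (PProj n i) = n"
| "arity (PComp n g hs) = n"
| "arity (PRec g h) = Suc (arity g)"

fun wf_sym :: "prsym \<Rightarrow> bool" where
  "wf_sym PZero \<longleftrightarrow> True"
| "wf_sym PSucc \<longleftrightarrow> True"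
| "wf_sym (PProj n i) \<longleftrightarrow> i < n"
| "wf_sym (PComp n g hs) \<longleftrightarrow>
     wf_sym g \<and> arity g = length hs \<and> (\<forall>h\<in>set hs. wf_sym h \<and> arity h = n)"
| "wf_sym (PRec g h) \<longleftrightarrow> wf_sym g \<and> wf_sym h \<and> arity h = arity g + 2"

datatype trm = Var nat | Fn prsym "trm list"

abbreviation Zero :: trm where "Zero \<equiv> Fn PZero []"
abbreviation Succ :: "trm \<Rightarrow> trm" where "Succ t \<equiv> Fn PSucc [t]"

datatype fm =
    Eq trm trm
  | Bot
  | Conj fm fm
  | Disj fm fm
  | Imp fm fm (infixr "\<^bold>\<longrightarrow>" 55)
  | Uni nat fm
  | Exi nat fm
  | Box fm
  | Pr fm

abbreviation Neg :: "fm \<Rightarrow> fm" where "Neg A \<equiv> A \<^bold>\<longrightarrow> Bot"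
abbreviation Dia :: "fm \<Rightarrow> fm" where "Dia A \<equiv> Neg (Box (Neg A))"

fun wf_trm :: "trm \<Rightarrow> bool" where
  "wf_trm (Var x) \<longleftrightarrow> True"
| "wf_trm (Fn f ts) \<longleftrightarrow> wf_sym f \<and> length ts = arity f \<and> (\<forall>t\<in>set ts. wf_trm t)"

fun wf_fm :: "fm \<Rightarrow> bool" where
  "wf_fm (Eq s t) \<longleftrightarrow> wf_trm s \<and> wf_trm t"
| "wf_fm Bot \<longleftrightarrow> True"
| "wf_fm (Conj A B) \<longleftrightarrow> wf_fm A \<and> wf_fm B"
| "wf_fm (Disj A B) \<longleftrightarrow> wf_fm A \<and> wf_fm B"
| "wf_fm (A \<^bold>\<longrightarrow> B) \<longleftrightarrow> wf_fm A \<and> wf_fm B"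
| "wf_fm (Uni x A) \<longleftrightarrow> wf_fm A"
| "wf_fm (Exi x A) \<longleftrightarrow> wf_fm A"
| "wf_fm (Box A) \<longleftrightarrow> wf_fm A"
| "wf_fm (Pr A) \<longleftrightarrow> wf_fm A"

fun modal_free :: "fm \<Rightarrow> bool" where
  "modal_free (Eq s t) \<longleftrightarrow> True"
| "modal_free Bot \<longleftrightarrow> True"
| "modal_free (Conj A B) \<longleftrightarrow> modal_free A \<and> modal_free B"
| "modal_free (Disj A B) \<longleftrightarrow> modal_free A \<and> modal_free B"
| "modal_free (A \<^bold>\<longrightarrow> B) \<longleftrightarrow> modal_free A \<and> modal_free B"
| "modal_free (Uni x A) \<longleftrightarrow> modal_free A"
| "modal_free (Exi x A) \<longleftrightarrow> modal_free A"
| "modal_free (Box A) \<longleftrightarrow> False"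
| "modal_free (Pr A) \<longleftrightarrow> False"

fun vars :: "trm \<Rightarrow> nat set" where
  "vars (Var x) = {x}"
| "vars (Fn f ts) = (\<Union>t\<in>set ts. vars t)"

fun FV :: "fm \<Rightarrow> nat set" where
  "FV (Eq s t) = vars s \<union> vars t"
| "FV Bot = {}"
| "FV (Conj A B) = FV A \<union> FV B"
| "FV (Disj A B) = FV A \<union> FV B"
| "FV (A \<^bold>\<longrightarrow> B) = FV A \<union> FV B"
| "FV (Uni x A) = FV A - {x}"
| "FV (Exi x A) = FV A - {x}"
| "FV (Box A) = FV A"
| "FV (Pr A) = FV A"

fun subst_trm :: "nat \<Rightarrow> trm \<Rightarrow> trm \<Rightarrow> trm" where
  "subst_trm x t (Var y) = (if y = x then t else Var y)"
| "subst_trm x t (Fn f ts) = Fn f (map (subst_trm x t) ts)"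

text \<open>Substitution does not rename bound variables; its uses below are guarded by \<open>free_for\<close>.\<close>

fun subst :: "nat \<Rightarrow> trm \<Rightarrow> fm \<Rightarrow> fm" where
  "subst x t (Eq r s) = Eq (subst_trm x t r) (subst_trm x t s)"
| "subst x t Bot = Bot"
| "subst x t (Conj A B) = Conj (subst x t A) (subst x t B)"
| "subst x t (Disj A B) = Disj (subst x t A) (subst x t B)"
| "subst x t (A \<^bold>\<longrightarrow> B) = (subst x t A \<^bold>\<longrightarrow> subst x t B)"
| "subst x t (Uni y A) = Uni y (if y = x then A else subst x t A)"
| "subst x t (Exi y A) = Exi y (if y = x then A else subst x t A)"
| "subst x t (Box A) = Box (subst x t A)"
| "subst x t (Pr A) = Pr (subst x t A)"

fun free_for :: "trm \<Rightarrow> nat \<Rightarrow> fm \<Rightarrow> bool" where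
  "free_for t x (Eq r s) \<longleftrightarrow> True"
| "free_for t x Bot \<longleftrightarrow> True"
| "free_for t x (Conj A B) \<longleftrightarrow> free_for t x A \<and> free_for t x B"
| "free_for t x (Disj A B) \<longleftrightarrow> free_for t x A \<and> free_for t x B"
| "free_for t x (A \<^bold>\<longrightarrow> B) \<longleftrightarrow> free_for t x A \<and> free_for t x B"
| "free_for t x (Uni y A) \<longleftrightarrow> x \<notin> FV (Uni y A) \<or> (y \<notin> vars t \<and> free_for t x A)"
| "free_for t x (Exi y A) \<longleftrightarrow> x \<notin> FV (Exi y A) \<or> (y \<notin> vars t \<and> free_for t x A)"
| "free_for t x (Box A) \<longleftrightarrow> free_for t x A"
| "free_for t x (Pr A) \<longleftrightarrow> free_for t x A"

section \<open>Axioms\<close>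

text \<open>The schemata range over the full modal language. The systems below select the instances
  that are well-formed and, for Heyting arithmetic, free of \<open>Box\<close> and \<open>Pr\<close>.\<close>

inductive int_ax :: "fm \<Rightarrow> bool" where
  "int_ax (A \<^bold>\<longrightarrow> B \<^bold>\<longrightarrow> A)"
| "int_ax ((A \<^bold>\<longrightarrow> B \<^bold>\<longrightarrow> C) \<^bold>\<longrightarrow> (A \<^bold>\<longrightarrow> B) \<^bold>\<longrightarrow> A \<^bold>\<longrightarrow> C)"
| "int_ax (A \<^bold>\<longrightarrow> B \<^bold>\<longrightarrow> Conj A B)"
| "int_ax (Conj A B \<^bold>\<longrightarrow> A)"
| "int_ax (Conj A B \<^bold>\<longrightarrow> B)"
| "int_ax (A \<^bold>\<longrightarrow> Disj A B)"
| "int_ax (B \<^bold>\<longrightarrow> Disj A B)"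
| "int_ax ((A \<^bold>\<longrightarrow> C) \<^bold>\<longrightarrow> (B \<^bold>\<longrightarrow> C) \<^bold>\<longrightarrow> Disj A B \<^bold>\<longrightarrow> C)"
| "int_ax (Bot \<^bold>\<longrightarrow> A)"
| "free_for t x A \<Longrightarrow> int_ax (Uni x A \<^bold>\<longrightarrow> subst x t A)"
| "free_for t x A \<Longrightarrow> int_ax (subst x t A \<^bold>\<longrightarrow> Exi x A)"
| "int_ax (Eq t t)"
| "free_for s x A \<Longrightarrow> free_for t x A \<Longrightarrow> int_ax (Eq s t \<^bold>\<longrightarrow> subst x s A \<^bold>\<longrightarrow> subst x t A)"

inductive arith_ax :: "fm \<Rightarrow> bool" where
  "arith_ax (Neg (Eq (Succ t) Zero))"
| "arith_ax (Eq (Succ s) (Succ t) \<^bold>\<longrightarrow> Eq s t)"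
| "arith_ax (Conj (subst x Zero A) (Uni x (A \<^bold>\<longrightarrow> subst x (Succ (Var x)) A)) \<^bold>\<longrightarrow> Uni x A)"
| "i < n \<Longrightarrow> length ts = n \<Longrightarrow> arith_ax (Eq (Fn (PProj n i) ts) (ts ! i))"
| "arith_ax (Eq (Fn (PComp n g hs) ts) (Fn g (map (\<lambda>h. Fn h ts) hs)))"
| "arith_ax (Eq (Fn (PRec g h) (Zero # ts)) (Fn g ts))"
| "arith_ax (Eq (Fn (PRec g h) (Succ t # ts)) (Fn h (t # Fn (PRec g h) (t # ts) # ts)))"

inductive modal_ax :: "fm \<Rightarrow> bool" where
  M1: "modal_ax (Box A \<^bold>\<longrightarrow> A)"
| M2: "modal_ax (Conj (Box A) (Box (A \<^bold>\<longrightarrow> B)) \<^bold>\<longrightarrow> Box B)"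
| M4: "modal_ax (Dia A \<^bold>\<longrightarrow> Box (Dia A))"
| M5: "modal_free A \<Longrightarrow> modal_ax (Dia A \<^bold>\<longrightarrow> A)"
| M6: "modal_ax (Dia (Exi x A) \<^bold>\<longrightarrow> Exi x (Dia A))"
| E1: "modal_ax (Pr A \<^bold>\<longrightarrow> A)"
| E2: "modal_ax (Pr A \<^bold>\<longrightarrow> Pr (Pr A))"
| ME2: "modal_ax (Conj (Dia (Pr A)) (Dia (Pr (A \<^bold>\<longrightarrow> B))) \<^bold>\<longrightarrow> Dia (Pr B))"

section \<open>The systems HA and MEA\<close>

inductive HA :: "fm \<Rightarrow> bool" where
  HA_logic: "int_ax A \<Longrightarrow> wf_fm A \<Longrightarrow> modal_free A \<Longrightarrow> HA A"
| HA_arith: "arith_ax A \<Longrightarrow> wf_fm A \<Longrightarrow> modal_free A \<Longrightarrow> HA A"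
| HA_MP: "HA A \<Longrightarrow> HA (A \<^bold>\<longrightarrow> B) \<Longrightarrow> HA B"
| HA_Uni: "HA (A \<^bold>\<longrightarrow> B) \<Longrightarrow> x \<notin> FV A \<Longrightarrow> HA (A \<^bold>\<longrightarrow> Uni x B)"
| HA_Exi: "HA (A \<^bold>\<longrightarrow> B) \<Longrightarrow> x \<notin> FV B \<Longrightarrow> HA (Exi x A \<^bold>\<longrightarrow> B)"

inductive MEA :: "fm \<Rightarrow> bool" where
  MEA_logic: "int_ax A \<Longrightarrow> wf_fm A \<Longrightarrow> MEA A"
| MEA_LEM: "wf_fm A \<Longrightarrow> MEA (Disj A (Neg A))"
| MEA_arith: "arith_ax A \<Longrightarrow> wf_fm A \<Longrightarrow> MEA A"
| MEA_modal: "modal_ax A \<Longrightarrow> wf_fm A \<Longrightarrow> MEA A"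
| MEA_MP: "MEA A \<Longrightarrow> MEA (A \<^bold>\<longrightarrow> B) \<Longrightarrow> MEA B"
| MEA_Uni: "MEA (A \<^bold>\<longrightarrow> B) \<Longrightarrow> x \<notin> FV A \<Longrightarrow> MEA (A \<^bold>\<longrightarrow> Uni x B)"
| MEA_Exi: "MEA (A \<^bold>\<longrightarrow> B) \<Longrightarrow> x \<notin> FV B \<Longrightarrow> MEA (Exi x A \<^bold>\<longrightarrow> B)"
| M3: "MEA A \<Longrightarrow> MEA (Box A)"
| ME1: "MEA A \<Longrightarrow> MEA (Dia (Pr A))"

section \<open>Markov's rule and its modal-epistemic versions\<close>

definition binary_symbol :: "prsym \<Rightarrow> bool" where
  "binary_symbol f \<longleftrightarrow> wf_sym f \<and> arity f = 2"

abbreviation R :: "prsym \<Rightarrow> nat \<Rightarrow> nat \<Rightarrow> fm" where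
  "R f x y \<equiv> Eq (Fn f [Var x, Var y]) Zero"

definition MR :: bool where
  "MR \<longleftrightarrow> (\<forall>f x y. binary_symbol f \<longrightarrow> x \<noteq> y \<longrightarrow>
     HA (Uni x (Neg (Neg (Exi y (R f x y))))) \<longrightarrow>
     HA (Uni x (Exi y (R f x y))))"

definition HMR_Nt :: bool where
  "HMR_Nt \<longleftrightarrow> (\<forall>f x y. binary_symbol f \<longrightarrow> x \<noteq> y \<longrightarrow>
     MEA (Dia (Pr (Uni x (Neg (Dia (Pr (Neg (Exi y (R f x y))))))))) \<longrightarrow>
     MEA (Dia (Pr (Uni x (Exi y (R f x y))))))"

definition HMR_W1 :: bool where
  "HMR_W1 \<longleftrightarrow> (\<forall>f x y. binary_symbol f \<longrightarrow> x \<noteq> y \<longrightarrow>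
     MEA (Dia (Uni x (Dia (Pr (Exi y (R f x y)))))) \<longrightarrow>
     MEA (Dia (Pr (Uni x (Exi y (R f x y))))))"

definition HMR_W2 :: bool where
  "HMR_W2 \<longleftrightarrow> (\<forall>f x y. binary_symbol f \<longrightarrow> x \<noteq> y \<longrightarrow>
     MEA (Box (Uni x (Neg (Dia (Pr (Neg (Exi y (R f x y)))))))) \<longrightarrow>
     MEA (Box (Uni x (Exi y (R f x y)))))"

definition HMR_W3 :: bool where
  "HMR_W3 \<longleftrightarrow> (\<forall>f x y. binary_symbol f \<longrightarrow> x \<noteq> y \<longrightarrow>
     MEA (Box (Uni x (Dia (Exi y (R f x y))))) \<longrightarrow>
     MEA (Box (Uni x (Exi y (R f x y)))))"

end

theory Submission
  imports Defs
begin

text \<open>Erasing \<open>Box\<close> and \<open>Pr\<close> turns every axiom and rule of MEA into a classically valid one, since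
  \<open>Dia A\<close> becomes a double negation; hence MEA is closed under erasure. Each premise of the four
  rules erases to a formula that is classically equivalent to \<open>\<forall>x \<exists>y R(x,y)\<close>. So this formula
  is a theorem of MEA, and necessitation or ME*1 yields the conclusion.\<close>

section \<open>Erasure and its action on the axiom schemata\<close>

fun erase :: "fm \<Rightarrow> fm" where
  "erase (Eq s t) = Eq s t"
| "erase Bot = Bot"
| "erase (Conj A B) = Conj (erase A) (erase B)"
| "erase (Disj A B) = Disj (erase A) (erase B)"
| "erase (A \<^bold>\<longrightarrow> B) = (erase A \<^bold>\<longrightarrow> erase B)"
| "erase (Uni x A) = Uni x (erase A)"
| "erase (Exi x A) = Exi x (erase A)"
| "erase (Box A) = erase A"
| "erase (Pr A) = erase A"

lemma wf_erase [simp]: "wf_fm (erase A) \<longleftrightarrow> wf_fm A"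
  by (induction A) auto

lemma FV_erase [simp]: "FV (erase A) = FV A"
  by (induction A) auto

lemma erase_subst [simp]: "erase (subst x t A) = subst x t (erase A)"
  by (induction A) auto

lemma free_for_erase [simp]: "free_for t x (erase A) \<longleftrightarrow> free_for t x A"
  by (induction A) auto

text \<open>Erasure commutes with the connectives, the quantifiers and substitution, and it keeps
  the \<open>free_for\<close> side conditions, so an instance of a schema becomes an instance of the
  same schema.\<close>

lemma int_ax_erase: "int_ax A \<Longrightarrow> int_ax (erase A)"
  by (induction rule: int_ax.induct;
      simp only: erase.simps erase_subst; rule int_ax.intros; simp only: free_for_erase)

lemma arith_ax_erase: "arith_ax A \<Longrightarrow> arith_ax (erase A)"
  by (induction rule: arith_ax.induct;
      simp only: erase.simps erase_subst; rule arith_ax.intros; assumption)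

lemma subst_trm_Var_self [simp]: "subst_trm x (Var x) t = t"
  by (induction t) (simp_all add: map_idI)

lemma subst_Var_self [simp]: "subst x (Var x) A = A"
  by (induction A) auto

text \<open>A quantifier that could capture \<open>x\<close> binds \<open>x\<close> itself, so
  \<open>x\<close> is not free in that subformula. Hence a quantified formula may be instantiated
  with its own bound variable.\<close>

lemma free_for_Var_self [simp]: "free_for (Var x) x A"
  by (induction A) auto

lemma MEA_wf: "MEA A \<Longrightarrow> wf_fm A"
  by (induction rule: MEA.induct) auto

section \<open>Derivations from hypotheses and the deduction theorem\<close>

text \<open>Modus ponens is the only rule that acts on hypotheses; the quantifier rules, M*3 and
  ME*1 enter only through theorems of MEA. This makes the deduction theorem hold with no condition
  on free variables or modal operators.\<close>

inductive derives :: "fm set \<Rightarrow> fm \<Rightarrow> bool" (infix "\<tturnstile>" 50) for H where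
  hyp: "A \<in> H \<Longrightarrow> wf_fm A \<Longrightarrow> H \<tturnstile> A"
| provable: "MEA A \<Longrightarrow> H \<tturnstile> A"
| mp: "H \<tturnstile> A \<Longrightarrow> H \<tturnstile> A \<^bold>\<longrightarrow> B \<Longrightarrow> H \<tturnstile> B"

lemma derives_wf: "H \<tturnstile> A \<Longrightarrow> wf_fm A"
  by (induction rule: derives.induct) (auto dest: MEA_wf)

lemma derives_empty: "{} \<tturnstile> A \<Longrightarrow> MEA A"
  by (induction rule: derives.induct) (auto intro: MEA_MP)

lemma derives_ax: "int_ax A \<Longrightarrow> wf_fm A \<Longrightarrow> H \<tturnstile> A"
  by (intro provable MEA_logic)

lemma derives_weaken: "H \<tturnstile> B \<Longrightarrow> wf_fm A \<Longrightarrow> H \<tturnstile> A \<^bold>\<longrightarrow> B"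
  by (rule mp, assumption, rule derives_ax) (auto intro: int_ax.intros dest: derives_wf)

lemma derives_dist:
  assumes "H \<tturnstile> A \<^bold>\<longrightarrow> B \<^bold>\<longrightarrow> C" and "H \<tturnstile> A \<^bold>\<longrightarrow> B"
  shows "H \<tturnstile> A \<^bold>\<longrightarrow> C"
proof -
  have "H \<tturnstile> (A \<^bold>\<longrightarrow> B \<^bold>\<longrightarrow> C) \<^bold>\<longrightarrow> (A \<^bold>\<longrightarrow> B) \<^bold>\<longrightarrow> A \<^bold>\<longrightarrow> C"
    using derives_wf[OF assms(1)] by (intro derives_ax int_ax.intros) auto
  with assms show ?thesis by (blast intro: mp)
qed

lemma derives_refl:
  assumes "wf_fm A"
  shows "H \<tturnstile> A \<^bold>\<longrightarrow> A"
proof (rule derives_dist)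
  show "H \<tturnstile> A \<^bold>\<longrightarrow> (A \<^bold>\<longrightarrow> A) \<^bold>\<longrightarrow> A" "H \<tturnstile> A \<^bold>\<longrightarrow> A \<^bold>\<longrightarrow> A"
    using assms by (auto intro!: derives_ax int_ax.intros)
qed

theorem deduction:
  assumes "insert A H \<tturnstile> B" and "wf_fm A"
  shows "H \<tturnstile> A \<^bold>\<longrightarrow> B"
  using assms(1)
proof (induction rule: derives.induct)
  case (hyp C)
  then show ?case using assms(2) by (auto intro: derives_refl derives_weaken derives.hyp)
next
  case (provable C)
  then show ?case using assms(2) by (auto intro: derives_weaken derives.provable)
next
  case (mp C D)
  then show ?case by (blast intro: derives_dist)
qed

lemma MEA_deduction: "{A} \<tturnstile> B \<Longrightarrow> wf_fm A \<Longrightarrow> MEA (A \<^bold>\<longrightarrow> B)"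
  by (intro derives_empty deduction)

lemma derives_conj:
  assumes "H \<tturnstile> Conj A B"
  shows "H \<tturnstile> A" and "H \<tturnstile> B"
proof -
  have "H \<tturnstile> Conj A B \<^bold>\<longrightarrow> A" "H \<tturnstile> Conj A B \<^bold>\<longrightarrow> B"
    using derives_wf[OF assms] by (auto intro: derives_ax int_ax.intros)
  with assms show "H \<tturnstile> A" "H \<tturnstile> B" by (blast intro: mp)+
qed

section \<open>Classical and quantifier laws in MEA\<close>

lemma MEA_refl: "wf_fm A \<Longrightarrow> MEA (A \<^bold>\<longrightarrow> A)"
  by (intro derives_empty derives_refl)

lemma MEA_trans:
  assumes "MEA (A \<^bold>\<longrightarrow> B)" and "MEA (B \<^bold>\<longrightarrow> C)"
  shows "MEA (A \<^bold>\<longrightarrow> C)"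
proof (rule MEA_deduction)
  show wf: "wf_fm A" using MEA_wf[OF assms(1)] by simp
  have "{A} \<tturnstile> A" using wf by (auto intro: hyp)
  then show "{A} \<tturnstile> C" by (rule mp[OF mp[OF _ provable[OF assms(1)]] provable[OF assms(2)]])
qed

lemma MEA_not_not_I:
  assumes "wf_fm A"
  shows "MEA (A \<^bold>\<longrightarrow> Neg (Neg A))"
proof (intro MEA_deduction deduction)
  let ?H = "{Neg A, A}"
  have "?H \<tturnstile> A" "?H \<tturnstile> Neg A" using assms by (auto intro: hyp)
  then show "?H \<tturnstile> Bot" by (rule mp)
qed (use assms in auto)

lemma MEA_not_not_E:
  assumes "wf_fm A"
  shows "MEA (Neg (Neg A) \<^bold>\<longrightarrow> A)"
proof (rule MEA_deduction)
  let ?H = "{Neg (Neg A)}"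
  have "insert (Neg A) ?H \<tturnstile> Neg A" "insert (Neg A) ?H \<tturnstile> Neg (Neg A)"
    using assms by (auto intro: hyp)
  then have "insert (Neg A) ?H \<tturnstile> Bot" by (rule mp)
  moreover have "insert (Neg A) ?H \<tturnstile> Bot \<^bold>\<longrightarrow> A"
    using assms by (auto intro: derives_ax int_ax.intros)
  ultimately have "insert (Neg A) ?H \<tturnstile> A" by (rule mp)
  \<comment> \<open>What follows is a case distinction on excluded middle: \<open>A\<close> implies
    \<open>A\<close> trivially, and \<open>Neg A\<close> implies \<open>A\<close> by ex
    falso.\<close>
  then have *: "?H \<tturnstile> Neg A \<^bold>\<longrightarrow> A" using assms by (auto intro: deduction)
  have "?H \<tturnstile> (A \<^bold>\<longrightarrow> A) \<^bold>\<longrightarrow> (Neg A \<^bold>\<longrightarrow> A) \<^bold>\<longrightarrow> Disj A (Neg A) \<^bold>\<longrightarrow> A"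
    using assms by (intro derives_ax int_ax.intros) auto
  from mp[OF derives_refl[OF assms] this]
  have "?H \<tturnstile> Disj A (Neg A) \<^bold>\<longrightarrow> A" by (rule mp[OF *])
  with provable[OF MEA_LEM[OF assms]] show "?H \<tturnstile> A" by (rule mp)
qed (use assms in auto)

lemma MEA_not_notD: "MEA (Neg (Neg A)) \<Longrightarrow> MEA A"
  by (rule MEA_MP, assumption, rule MEA_not_not_E) (auto dest: MEA_wf)

lemma MEA_Uni_iff: "MEA (Uni x A) \<longleftrightarrow> MEA A"
proof
  assume *: "MEA (Uni x A)"
  have "int_ax (Uni x A \<^bold>\<longrightarrow> subst x (Var x) A)" by (intro int_ax.intros) simp
  then have "MEA (Uni x A \<^bold>\<longrightarrow> A)" using MEA_wf[OF *] by (intro MEA_logic) simp_all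
  with * show "MEA A" by (rule MEA_MP)
next
  assume "MEA A"
  \<comment> \<open>The generalization rule acts on implications only, so a provable closed
    antecedent is added and later discharged.\<close>
  then have "MEA (Neg Bot \<^bold>\<longrightarrow> A)" by (simp add: derives_empty derives_weaken provable)
  then have "MEA (Neg Bot \<^bold>\<longrightarrow> Uni x A)" by (rule MEA_Uni) simp
  then show "MEA (Uni x A)" by (rule MEA_MP[rotated]) (simp add: MEA_refl)
qed

lemma MEA_Exi_I:
  assumes "wf_fm A"
  shows "MEA (A \<^bold>\<longrightarrow> Exi x A)"
proof -
  have "int_ax (subst x (Var x) A \<^bold>\<longrightarrow> Exi x A)" by (intro int_ax.intros) simp
  with assms show ?thesis by (auto intro: MEA_logic)
qed

lemma MEA_Exi_mono:
  assumes "MEA (A \<^bold>\<longrightarrow> B)"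
  shows "MEA (Exi x A \<^bold>\<longrightarrow> Exi x B)"
proof (rule MEA_Exi)
  show "MEA (A \<^bold>\<longrightarrow> Exi x B)"
    using MEA_wf[OF assms] by (intro MEA_trans[OF assms] MEA_Exi_I) simp
qed simp

text \<open>The erased form of M*2.\<close>

lemma MEA_conj_mp:
  assumes "wf_fm A" and "wf_fm B"
  shows "MEA (Conj A (A \<^bold>\<longrightarrow> B) \<^bold>\<longrightarrow> B)"
proof (rule MEA_deduction)
  have "{Conj A (A \<^bold>\<longrightarrow> B)} \<tturnstile> Conj A (A \<^bold>\<longrightarrow> B)" using assms by (auto intro: hyp)
  from derives_conj[OF this] show "{Conj A (A \<^bold>\<longrightarrow> B)} \<tturnstile> B" by (rule mp)
qed (use assms in auto)

text \<open>The erased form of ME*2, as \<open>Dia (Pr A)\<close> erases to the double negation of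
  \<open>erase A\<close>.\<close>

lemma MEA_conj_mp_not_not:
  assumes "wf_fm A" and "wf_fm B"
  shows "MEA (Conj (Neg (Neg A)) (Neg (Neg (A \<^bold>\<longrightarrow> B))) \<^bold>\<longrightarrow> Neg (Neg B))"
proof (rule MEA_deduction)
  let ?C = "Conj (Neg (Neg A)) (Neg (Neg (A \<^bold>\<longrightarrow> B)))"
  have "{?C} \<tturnstile> ?C" using assms by (auto intro: hyp)
  then have "{?C} \<tturnstile> Neg (Neg A)" "{?C} \<tturnstile> Neg (Neg (A \<^bold>\<longrightarrow> B))"
    by (rule derives_conj)+
  from this[THEN mp, OF provable, OF MEA_not_not_E] assms
  have "{?C} \<tturnstile> A" "{?C} \<tturnstile> A \<^bold>\<longrightarrow> B" by simp_all
  then have "{?C} \<tturnstile> B" by (rule mp)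
  then show "{?C} \<tturnstile> Neg (Neg B)" by (rule mp[OF _ provable[OF MEA_not_not_I[OF assms(2)]]])
qed (use assms in auto)

text \<open>The erased form of M*6: the outer double negation is removed classically and a new one
  is put under the quantifier by monotonicity.\<close>

lemma MEA_not_not_Exi:
  assumes "wf_fm A"
  shows "MEA (Neg (Neg (Exi x A)) \<^bold>\<longrightarrow> Exi x (Neg (Neg A)))"
  using assms by (intro MEA_trans[OF MEA_not_not_E MEA_Exi_mono] MEA_not_not_I) auto

section \<open>Closure of MEA under erasure\<close>

text \<open>M*1, M*4, E*1 and E*2 all collapse to an implication from a formula to itself, and M*5
  becomes double negation elimination.\<close>

lemma modal_ax_erase: "modal_ax A \<Longrightarrow> wf_fm A \<Longrightarrow> MEA (erase A)"
  by (induction rule: modal_ax.induct)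
    (simp_all add: MEA_refl MEA_conj_mp MEA_not_not_E MEA_not_not_Exi MEA_conj_mp_not_not)

theorem MEA_erase: "MEA A \<Longrightarrow> MEA (erase A)"
proof (induction rule: MEA.induct)
  case (MEA_logic A)
  then show ?case by (simp add: MEA.MEA_logic int_ax_erase)
next
  case (MEA_LEM A)
  then show ?case by (simp add: MEA.MEA_LEM)
next
  case (MEA_arith A)
  then show ?case by (simp add: MEA.MEA_arith arith_ax_erase)
next
  case (MEA_modal A)
  then show ?case by (rule modal_ax_erase)
next
  case (MEA_MP A B)
  then show ?case by (auto intro: MEA.MEA_MP)
next
  case (MEA_Uni A B x)
  then show ?case by (simp add: MEA.MEA_Uni)
next
  case (MEA_Exi A B x)
  then show ?case by (simp add: MEA.MEA_Exi)
next
  case (M3 A)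
  \<comment> \<open>Premise and conclusion of M*3 have the same erasure.\<close>
  then show ?case by simp
next
  case (ME1 A)
  then have "MEA (erase A \<^bold>\<longrightarrow> Neg (Neg (erase A)))" by (intro MEA_not_not_I MEA_wf)
  with ME1 show ?case by (auto intro: MEA.MEA_MP)
qed

theorem theorem7p3:
  assumes MR
  shows "HMR_Nt \<and> HMR_W1 \<and> HMR_W2 \<and> HMR_W3"
proof (intro conjI)
  \<comment> \<open>By ME*1 it suffices to prove the formula under \<open>Dia (Pr _)\<close>. The
    premise erases to a doubly negated universal formula with four negations before
    \<open>Exi y (R f x y)\<close>; these are stripped in pairs, with the quantifier removed in
    between.\<close>
  show HMR_Nt
    unfolding HMR_Nt_def
    by (intro allI impI ME1, drule MEA_erase) (auto simp: MEA_Uni_iff dest!: MEA_not_notD)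
  show HMR_W1
    unfolding HMR_W1_def
    by (intro allI impI ME1, drule MEA_erase) (auto simp: MEA_Uni_iff dest!: MEA_not_notD)
  \<comment> \<open>The conclusion is now boxed, so M*3 takes the place of ME*1.\<close>
  show HMR_W2
    unfolding HMR_W2_def
    by (intro allI impI M3, drule MEA_erase) (auto simp: MEA_Uni_iff dest!: MEA_not_notD)
  show HMR_W3
    unfolding HMR_W3_def
    by (intro allI impI M3, drule MEA_erase) (auto simp: MEA_Uni_iff dest!: MEA_not_notD)
qed

end
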